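(* Let $S$ be a semigroup and let $e\in S$. Then $\mathbf{RZ}(e)\neq\emptyset$ if and only if $e$ is an idempotent. In this case, $\mathbf{RZ}(e)$ is the maximum right zero subsemigroup of $S$ containing $e$.
   Context: For $e$ in a semigroup $S$, $\mathbf{RZ}(e)=\mathcal{LI}(e)\cap\mathcal{RZ}(e)$, where $\mathcal{LI}(e)=\{b\in S\mid be=e\}$ and $\mathcal{RZ}(e)=\{b\in S\mid eb=b\}$. A right zero semigroup is one in which $ab=b$ for all $a,b$. "Maximum" is with respect to inclusion: it is itself a right zero subsemigroup containing $e$ and contains every right zero subsemigroup of $S$ containing $e$. *)

theory Defs imports Main begin

text \<open>The ambient semigroup \<open>S\<close> is a type of class \<^class>\<open>semigroup_mult\<close>; its
  subsemigroups are sets of elements. The calligraphic \<open>LI(e)\<close>, \<open>RZ(e)\<close> are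
  \<open>left_ids\<close>, \<open>right_absorbed\<close>; the bold \<open>RZ(e)\<close> is \<open>RZ\<close>.\<close>

definition left_ids :: "'a::semigroup_mult \<Rightarrow> 'a set" where
  "left_ids e = {b. b * e = e}"

definition right_absorbed :: "'a::semigroup_mult \<Rightarrow> 'a set" where
  "right_absorbed e = {b. e * b = b}"

definition RZ :: "'a::semigroup_mult \<Rightarrow> 'a set" where
  "RZ e = left_ids e \<inter> right_absorbed e"

definition idempotent_elem :: "'a::semigroup_mult \<Rightarrow> bool" where
  "idempotent_elem e \<longleftrightarrow> e * e = e"

definition subsemigroup :: "'a::semigroup_mult set \<Rightarrow> bool" where
  "subsemigroup T \<longleftrightarrow> T \<noteq> {} \<and> (\<forall>a\<in>T. \<forall>b\<in>T. a * b \<in> T)"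

definition right_zero_subsemigroup :: "'a::semigroup_mult set \<Rightarrow> bool" where
  "right_zero_subsemigroup T \<longleftrightarrow> subsemigroup T \<and> (\<forall>a\<in>T. \<forall>b\<in>T. a * b = b)"

definition maximum_right_zero_subsemigroup_containing ::
    "'a::semigroup_mult \<Rightarrow> 'a set \<Rightarrow> bool" where
  "maximum_right_zero_subsemigroup_containing e M \<longleftrightarrow>
     right_zero_subsemigroup M \<and> e \<in> M \<and>
     (\<forall>T. right_zero_subsemigroup T \<and> e \<in> T \<longrightarrow> T \<subseteq> M)"

end

theory Submission imports Defs begin

text \<open>The two equations defining \<open>RZ e\<close> are the right zero law for the pairs (b,
  e) and (e, b). Conversely, \<open>e\<close> links any two members: it can be inserted in front of
  a member, and it absorbs a member standing to its left. This forces the right zero law on all of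
  \<open>RZ e\<close> (\<open>RZ_mult\<close>), and a single member already makes \<open>e\<close>
  idempotent (\<open>idempotent_if_mem_RZ\<close>).\<close>

lemma mem_RZ_iff: "b \<in> RZ e \<longleftrightarrow> b * e = e \<and> e * b = b"
  by (simp add: RZ_def left_ids_def right_absorbed_def)

lemma idempotent_if_mem_RZ:
  assumes "b \<in> RZ e"
  shows "idempotent_elem e"
proof -
  have b: "b * e = e" "e * b = b"
    using assms by (simp_all add: mem_RZ_iff)
  \<comment> \<open>Expanding the second factor to \<open>b * e\<close> lets the first
    \<open>e\<close> cancel against \<open>b\<close>.\<close>
  have "e * e = e * (b * e)" by (simp only: b(1))
  also have "\<dots> = (e * b) * e" by (simp only: mult.assoc)
  also have "\<dots> = e" by (simp only: b)
  finally show ?thesis by (simp add: idempotent_elem_def)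
qed

lemma mem_RZ_self_iff: "e \<in> RZ e \<longleftrightarrow> idempotent_elem e"
  by (simp add: mem_RZ_iff idempotent_elem_def)

lemma RZ_mult:
  assumes "a \<in> RZ e" "b \<in> RZ e"
  shows "a * b = b"
proof -
  have ae: "a * e = e" and eb: "e * b = b"
    using assms by (simp_all add: mem_RZ_iff)
  have "a * b = a * (e * b)" by (simp only: eb)
  also have "\<dots> = (a * e) * b" by (simp only: mult.assoc)
  also have "\<dots> = b" by (simp only: ae eb)
  finally show ?thesis .
qed

text \<open>Closure comes for free: a product of members is its right factor.\<close>

lemma right_zero_subsemigroup_RZ:
  "RZ e \<noteq> {} \<Longrightarrow> right_zero_subsemigroup (RZ e)"
  by (simp add: right_zero_subsemigroup_def subsemigroup_def RZ_mult)

text \<open>As \<open>e\<close> lies in \<open>T\<close>, the right zero law may be used with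
  \<open>e\<close> on either side of a member.\<close>

lemma right_zero_subsemigroup_subset_RZ:
  "right_zero_subsemigroup T \<Longrightarrow> e \<in> T \<Longrightarrow> T \<subseteq> RZ e"
  by (auto simp: right_zero_subsemigroup_def mem_RZ_iff)

theorem proposition4p2:
  fixes e :: "'a::semigroup_mult"
  shows "(RZ e \<noteq> {} \<longleftrightarrow> idempotent_elem e) \<and>
    (idempotent_elem e \<longrightarrow> maximum_right_zero_subsemigroup_containing e (RZ e))"
proof (intro conjI impI)
  \<comment> \<open>For the converse direction the witness is \<open>e\<close> itself.\<close>
  show nonempty_iff: "RZ e \<noteq> {} \<longleftrightarrow> idempotent_elem e"
    using idempotent_if_mem_RZ mem_RZ_self_iff by blast
  assume "idempotent_elem e"
  then show "maximum_right_zero_subsemigroup_containing e (RZ e)"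
    unfolding maximum_right_zero_subsemigroup_containing_def
    using nonempty_iff mem_RZ_self_iff right_zero_subsemigroup_RZ
      right_zero_subsemigroup_subset_RZ by blast
qed

end
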